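(* Let $X$ be a finite-dimensional Euclidean space, let $A,B\subset X$ be closed, and let $\bar x\in A\cap B$. The following conditions are equivalent: (i) $\{A,B\}$ is intrinsically transversal at $\bar x$; (ii) there exists a number $\alpha\in]0,1[$ such that $\|v_1+v_2\|>\alpha$ for all $(v_1,v_2)\in\overline N_{A,B}(\bar x)$ with $\|v_1\|=\|v_2\|=1$; the exact upper bound of all such $\alpha$ equals $2\,\mathrm{itr}[A,B](\bar x)$; (iii) $\mathrm{itr}_1[A,B](\bar x)<2$, i.e., there exists a number $\alpha<2$ such that $\|v_1-v_2\|<\alpha$ for all $(v_1,v_2)\in\overline N_{A,B}(\bar x)$ with $\|v_1\|=\|v_2\|=1$; the exact lower bound of all such $\alpha$ equals $\mathrm{itr}_1[A,B](\bar x)$; (iv) $\mathrm{itr}_2[A,B](\bar x)<1$, i.e., there exists a number $\alpha<1$ such that $\langle v_1,v_2\rangle>-\alpha$ for all $(v_1,v_2)\in\overline N_{A,B}(\bar x)$ with $\|v_1\|=\|v_2\|=1$; the exact lower bound of all such $\alpha$ equals $\mathrm{itr}_2[A,B](\bar x)$; (v) $\mathrm{itr}_3[A,B](\bar x)>0$, i.e., there exists a number $\alpha\in]0,1[$ such that $d((v,-v),\overline N_{A,B}(\bar x))>\alpha$ for all $v\in X$ with $\|v\|=1$; the exact upper bound of all such $\alpha$ equals $\mathrm{itr}_3[A,B](\bar x)$.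
   Context: $X^*$ is identified with $X$ and $\langle\cdot,\cdot\rangle$ is the inner product. $\mathbb{B}_r(x)$ is the open ball with centre $x$ and radius $r$. The supremum of the empty subset of $\mathbb{R}_+$ is taken to be $0$. Fréchet normal cone to $A$ at $x\in A$: $N_A(x)=\{v\in X\mid \limsup_{a\to x,\,a\in A\setminus\{x\}}\langle v,a-x\rangle/\|a-x\|\le 0\}$ (all of $X$ if $x$ is isolated in $A$). The constant $\mathrm{itr}[A,B](\bar x)$: for $\delta>0$ let $I(\delta)$ be the infimum of $\|v_1+v_2\|$ over all $a\in(A\setminus B)\cap\mathbb{B}_\delta(\bar x)$, $b\in(B\setminus A)\cap\mathbb{B}_\delta(\bar x)$, $x\in\mathbb{B}_\delta(\bar x)$ with $x\ne a$, $x\ne b$, $1-\delta<\frac{\|x-a\|}{\|x-b\|}<1+\delta$, and all $v_1\in N_A(a)\setminus\{0\}$, $v_2\in N_B(b)\setminus\{0\}$ with $\|v_1\|+\|v_2\|=1$, $\frac{\langle v_1,x-a\rangle}{\|v_1\|\|x-a\|}>1-\delta$, $\frac{\langle v_2,x-b\rangle}{\|v_2\|\|x-b\|}>1-\delta$, where the infimum over the empty set equals $1$. Then $\mathrm{itr}[A,B](\bar x):=\lim_{\delta\downarrow0}I(\delta)$. The pair $\{A,B\}$ is intrinsically transversal at $\bar x$ if $\mathrm{itr}[A,B](\bar x)>0$. Pairs of relative limiting normals: $(v_1,v_2)\in X\times X$ belongs to $\overline N_{A,B}(\bar x)$ if there exist sequences $(a_k)\subset A\setminus B$, $(b_k)\subset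 B\setminus A$, $(x_k),(v_{1k}),(v_{2k})\subset X$ such that $x_k\ne a_k$, $x_k\ne b_k$ for all $k$, $a_k,b_k,x_k\to\bar x$, $v_{1k}\to v_1$, $v_{2k}\to v_2$, $v_{1k}\in N_A(a_k)$, $v_{2k}\in N_B(b_k)$ for all $k$, and $\frac{\|x_k-a_k\|}{\|x_k-b_k\|}\to1$, $\frac{\langle v_{1k},x_k-a_k\rangle}{\|v_{1k}\|\|x_k-a_k\|}\to1$, $\frac{\langle v_{2k},x_k-b_k\rangle}{\|v_{2k}\|\|x_k-b_k\|}\to1$, with the convention $\frac00=1$. Further constants: $\mathrm{itr}_1[A,B](\bar x):=\max\{\|v_1-v_2\| : (v_1,v_2)\in\overline N_{A,B}(\bar x),\ \|v_1\|=\|v_2\|=1\}$, the maximum over the empty set being $0$; $\mathrm{itr}_2[A,B](\bar x):=-\min\{\langle v_1,v_2\rangle : (v_1,v_2)\in\overline N_{A,B}(\bar x),\ \|v_1\|=\|v_2\|=1\}$, the minimum over the empty set being $1$; $\mathrm{itr}_3[A,B](\bar x):=\min_{\|v\|=1}d((v,-v),\overline N_{A,B}(\bar x))$, where $d$ is the Euclidean distance in $X\times X$ and the distance to the empty set is taken to be the distance to the origin, i.e., $\sqrt2$.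
   Formalization: Exact bounds: in (ii) α ranges over ]0,2[ (over ]0,1[ the bound is min(1, 2 itr)), in (v) over α>0 (over ]0,1[: min(1, itr_3)), in (iii) over [0,2[, in (iv) over [-1,1[, with value 2 resp. 1 if no α exists; as printed they fail for A=B. *)

theory Defs
  imports "HOL-Analysis.Analysis"
begin

text \<open>If \<open>x\<close> is isolated in \<open>A\<close> then \<open>at x within A\<close> is the trivial filter, whose \<open>Limsup\<close> in
  the extended reals is \<open>-\<infinity>\<close>, so the cone is the whole space. The definition is used only for
  \<open>x \<in> A\<close>.\<close>

definition frechet_normal_cone :: "'a::euclidean_space set \<Rightarrow> 'a \<Rightarrow> 'a set" where
  "frechet_normal_cone A x =
     {v. Limsup (at x within A) (\<lambda>a. ereal (inner v (a - x) / norm (a - x))) \<le> 0}"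

definition itr_values :: "'a::euclidean_space set \<Rightarrow> 'a set \<Rightarrow> 'a \<Rightarrow> real \<Rightarrow> real set" where
  "itr_values A B xbar \<delta> =
     {norm (v1 + v2) | v1 v2 a b x.
        a \<in> (A - B) \<inter> ball xbar \<delta> \<and> b \<in> (B - A) \<inter> ball xbar \<delta> \<and> x \<in> ball xbar \<delta> \<and>
        x \<noteq> a \<and> x \<noteq> b \<and>
        1 - \<delta> < norm (x - a) / norm (x - b) \<and> norm (x - a) / norm (x - b) < 1 + \<delta> \<and>
        v1 \<in> frechet_normal_cone A a - {0} \<and> v2 \<in> frechet_normal_cone B b - {0} \<and>
        norm v1 + norm v2 = 1 \<and>
        inner v1 (x - a) / (norm v1 * norm (x - a)) > 1 - \<delta> \<and>
        inner v2 (x - b) / (norm v2 * norm (x - b)) > 1 - \<delta>}"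

definition itr_inf :: "'a::euclidean_space set \<Rightarrow> 'a set \<Rightarrow> 'a \<Rightarrow> real \<Rightarrow> real" where
  "itr_inf A B xbar \<delta> =
     (if itr_values A B xbar \<delta> = {} then 1 else Inf (itr_values A B xbar \<delta>))"

definition itr :: "'a::euclidean_space set \<Rightarrow> 'a set \<Rightarrow> 'a \<Rightarrow> real" where
  "itr A B xbar = Lim (at_right 0) (itr_inf A B xbar)"

definition intrinsically_transversal :: "'a::euclidean_space set \<Rightarrow> 'a set \<Rightarrow> 'a \<Rightarrow> bool" where
  "intrinsically_transversal A B xbar \<longleftrightarrow> itr A B xbar > 0"

text \<open>Quotient with the convention \<open>0/0 = 1\<close>, in place of the built-in \<open>0/0 = 0\<close>; it makes zero
  normals admissible in the sequences below.\<close>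

definition quot1 :: "real \<Rightarrow> real \<Rightarrow> real" where
  "quot1 p q = (if p = 0 \<and> q = 0 then 1 else p / q)"

definition rel_limiting_normals ::
  "'a::euclidean_space set \<Rightarrow> 'a set \<Rightarrow> 'a \<Rightarrow> ('a \<times> 'a) set" where
  "rel_limiting_normals A B xbar =
     {(v1, v2). \<exists>(a :: nat \<Rightarrow> 'a) b x u1 u2.
        (\<forall>k. a k \<in> A - B \<and> b k \<in> B - A \<and> x k \<noteq> a k \<and> x k \<noteq> b k \<and>
             u1 k \<in> frechet_normal_cone A (a k) \<and> u2 k \<in> frechet_normal_cone B (b k)) \<and>
        a \<longlonglongrightarrow> xbar \<and> b \<longlonglongrightarrow> xbar \<and> x \<longlonglongrightarrow> xbar \<and> u1 \<longlonglongrightarrow> v1 \<and> u2 \<longlonglongrightarrow> v2 \<and>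
        (\<lambda>k. quot1 (norm (x k - a k)) (norm (x k - b k))) \<longlonglongrightarrow> 1 \<and>
        (\<lambda>k. quot1 (inner (u1 k) (x k - a k)) (norm (u1 k) * norm (x k - a k))) \<longlonglongrightarrow> 1 \<and>
        (\<lambda>k. quot1 (inner (u2 k) (x k - b k)) (norm (u2 k) * norm (x k - b k))) \<longlonglongrightarrow> 1}"

text \<open>Attained maximum and minimum of a possibly infinite set of reals, with a prescribed value
  for the empty set.\<close>

definition max_or :: "real \<Rightarrow> real set \<Rightarrow> real" where
  "max_or d S = (if S = {} then d else (GREATEST r. r \<in> S))"

definition min_or :: "real \<Rightarrow> real set \<Rightarrow> real" where
  "min_or d S = (if S = {} then d else (LEAST r. r \<in> S))"

definition itr1 :: "'a::euclidean_space set \<Rightarrow> 'a set \<Rightarrow> 'a \<Rightarrow> real" where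
  "itr1 A B xbar = max_or 0
     {norm (v1 - v2) | v1 v2.
        (v1, v2) \<in> rel_limiting_normals A B xbar \<and> norm v1 = 1 \<and> norm v2 = 1}"

definition itr2 :: "'a::euclidean_space set \<Rightarrow> 'a set \<Rightarrow> 'a \<Rightarrow> real" where
  "itr2 A B xbar = - min_or 1
     {inner v1 v2 | v1 v2.
        (v1, v2) \<in> rel_limiting_normals A B xbar \<and> norm v1 = 1 \<and> norm v2 = 1}"

text \<open>The distance to the empty set is the distance to the origin, whereas \<open>infdist p {} = 0\<close>.
  The product norm on pairs is the Euclidean one.\<close>

definition dist_to :: "'a::real_normed_vector \<Rightarrow> 'a set \<Rightarrow> real" where
  "dist_to p S = (if S = {} then norm p else infdist p S)"

text \<open>The minimum is over a nonempty set, since a type of class \<open>euclidean_space\<close> has positive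
  dimension.\<close>

definition itr3 :: "'a::euclidean_space set \<Rightarrow> 'a set \<Rightarrow> 'a \<Rightarrow> real" where
  "itr3 A B xbar =
     (LEAST r. r \<in> {dist_to (v, - v) (rel_limiting_normals A B xbar) | v. norm v = 1})"

text \<open>Exact upper and lower bounds of sets of admissible constants, with a prescribed value for
  the empty set (\<open>Sup {}\<close> and \<open>Inf {}\<close> are unspecified for reals).\<close>

definition sup_or :: "real \<Rightarrow> real set \<Rightarrow> real" where
  "sup_or d S = (if S = {} then d else Sup S)"

definition inf_or :: "real \<Rightarrow> real set \<Rightarrow> real" where
  "inf_or d S = (if S = {} then d else Inf S)"

end

theory Submission
  imports Defs
begin

text \<open>The constants \<open>itr\<close>, \<open>itr1\<close> and \<open>itr2\<close> are extremal values over one set, the pairs of relative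
  limiting normals with both components of norm one (\<open>unit_rel_normals\<close>).

  Let \<open>v1\<close>, \<open>v2\<close> be competitors in the infimum \<open>I(\<delta>)\<close>, with directions \<open>w1\<close>, \<open>w2\<close> and
  \<open>norm v1 + norm v2 = 1\<close>. Membership in the cones and the angle conditions depend on the
  directions only, so \<open>w1 / 2\<close>, \<open>w2 / 2\<close> compete as well, and they do at least as well, since
  \<open>norm (w1 + w2) / 2 \<le> norm (v1 + v2)\<close> (\<open>norm_midpoint_le\<close>). The infimum is thus taken over pairs
  of unit vectors, and compactness of the sphere turns near minimisers for \<open>\<delta> \<rightarrow> 0\<close> into a unit
  pair of limiting normals. Hence \<open>2 itr\<close> is the attained minimum of \<open>norm (v1 + v2)\<close> over the unit
  pairs (\<open>two_itr_attained\<close>), and \<open>itr = 1\<close> if there are none.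

  For unit vectors \<open>norm (v1 + v2)\<close>, \<open>norm (v1 - v2)\<close> and \<open>inner v1 v2\<close> determine one another
  monotonically. Therefore the same pair is extremal for \<open>itr1\<close> and \<open>itr2\<close>, and
  \<open>itr1 = 2 sqrt (1 - itr\<^sup>2)\<close>, \<open>itr2 = 1 - 2 itr\<^sup>2\<close> (\<open>itr1_itr2_eq\<close>); the values prescribed for empty
  sets fit these formulas. The distances that define \<open>itr3\<close> involve the pairs with other norms too.
  Their minimum is attained (\<open>itr3_attained\<close>), and as the pairs of limiting normals form a closed
  set it vanishes exactly if some \<open>(v, - v)\<close> with \<open>norm v = 1\<close> is such a pair, that is, if
  \<open>itr = 0\<close>.

  Each exact bound is then the end point of an interval of admissible constants, because a strict
  bound holds for all unit pairs if and only if it holds for the extremal one.\<close>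

section \<open>Cones of normals\<close>

lemma frechet_normal_cone_iff:
  "v \<in> frechet_normal_cone A x \<longleftrightarrow>
     (\<forall>e>0. \<forall>\<^sub>F a in at x within A. inner v (a - x) / norm (a - x) < e)"
proof -
  have "v \<in> frechet_normal_cone A x \<longleftrightarrow>
      (\<forall>y>0. \<forall>\<^sub>F a in at x within A. ereal (inner v (a - x) / norm (a - x)) < y)"
    by (simp add: frechet_normal_cone_def Limsup_le_iff)
  also have "\<dots> \<longleftrightarrow> (\<forall>e>0. \<forall>\<^sub>F a in at x within A. inner v (a - x) / norm (a - x) < e)"
  proof (intro iffI allI impI)
    fix e :: real
    assume "\<forall>y>0. \<forall>\<^sub>F a in at x within A. ereal (inner v (a - x) / norm (a - x)) < y"
      and "e > 0"
    from this(1)[rule_format, of "ereal e"] this(2)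
    show "\<forall>\<^sub>F a in at x within A. inner v (a - x) / norm (a - x) < e" by simp
  next
    fix y :: ereal
    assume *: "\<forall>e>0. \<forall>\<^sub>F a in at x within A. inner v (a - x) / norm (a - x) < e" and "y > 0"
    then obtain e where e: "0 < ereal e" "ereal e < y"
      using ereal_dense2 by blast
    then have "\<forall>\<^sub>F a in at x within A. inner v (a - x) / norm (a - x) < e" using * by simp
    then show "\<forall>\<^sub>F a in at x within A. ereal (inner v (a - x) / norm (a - x)) < y"
      by eventually_elim (use e in \<open>auto intro: less_trans[of _ "ereal e"]\<close>)
  qed
  finally show ?thesis .
qed

lemma frechet_normal_cone_scaleR:
  assumes "v \<in> frechet_normal_cone A x" and "t \<ge> 0"
  shows "t *\<^sub>R v \<in> frechet_normal_cone A x"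
proof (cases "t = 0")
  case True
  then show ?thesis by (simp add: frechet_normal_cone_iff)
next
  case False
  with assms have t: "t > 0" by simp
  show ?thesis unfolding frechet_normal_cone_iff
  proof (intro allI impI)
    fix e :: real assume "e > 0"
    then have "e / t > 0" using t by simp
    then have "\<forall>\<^sub>F a in at x within A. inner v (a - x) / norm (a - x) < e / t"
      using assms(1) frechet_normal_cone_iff by blast
    then show "\<forall>\<^sub>F a in at x within A. inner (t *\<^sub>R v) (a - x) / norm (a - x) < e"
      by eventually_elim (use t in \<open>simp add: field_simps\<close>)
  qed
qed

text \<open>Under the convention \<open>0/0 = 1\<close> the zero vector counts as parallel to every vector; hence scaling
  by \<open>0\<close> can only increase this number.\<close>

definition cosine :: "'a::euclidean_space \<Rightarrow> 'a \<Rightarrow> real" where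
  "cosine v w = quot1 (inner v w) (norm v * norm w)"

lemma cosine_le_1: "cosine v w \<le> 1"
proof (cases "v = 0 \<or> w = 0")
  case False
  then have "norm v * norm w > 0" by simp
  then show ?thesis
    using norm_cauchy_schwarz[of v w] False by (simp add: cosine_def quot1_def divide_le_eq_1)
qed (auto simp: cosine_def quot1_def)

lemma cosine_scaleR_ge:
  assumes "t \<ge> 0"
  shows "cosine v w \<le> cosine (t *\<^sub>R v) w"
proof (cases "t = 0")
  case True
  then show ?thesis using cosine_le_1[of v w] by (simp add: cosine_def quot1_def)
next
  case False
  with assms show ?thesis by (simp add: cosine_def quot1_def)
qed

section \<open>Approximate relative limiting normals\<close>

text \<open>The part common to the competitors in \<open>I(\<delta>)\<close> and to the sequences defining limiting pairs,
  without normalisation, so that the two vectors may be scaled independently. The upper halves of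
  the angle conditions are left out: a cosine never exceeds \<open>1\<close>.\<close>

definition near_normals :: "'a::euclidean_space set \<Rightarrow> 'a set \<Rightarrow> 'a \<Rightarrow> real \<Rightarrow> ('a \<times> 'a) set" where
  "near_normals A B xbar \<delta> = {(v1, v2). \<exists>a b x.
     a \<in> (A - B) \<inter> ball xbar \<delta> \<and> b \<in> (B - A) \<inter> ball xbar \<delta> \<and> x \<in> ball xbar \<delta> \<and>
     x \<noteq> a \<and> x \<noteq> b \<and> \<bar>norm (x - a) / norm (x - b) - 1\<bar> < \<delta> \<and>
     v1 \<in> frechet_normal_cone A a \<and> v2 \<in> frechet_normal_cone B b \<and>
     1 - \<delta> < cosine v1 (x - a) \<and> 1 - \<delta> < cosine v2 (x - b)}"

lemma near_normals_mono:
  assumes "\<delta> \<le> \<epsilon>"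
  shows "near_normals A B xbar \<delta> \<subseteq> near_normals A B xbar \<epsilon>"
proof -
  have "r < \<delta> \<Longrightarrow> r < \<epsilon>" "1 - \<delta> < r \<Longrightarrow> 1 - \<epsilon> < r" for r using assms by linarith+
  then show ?thesis unfolding near_normals_def mem_ball Int_iff by blast
qed

lemma near_normals_scaleR:
  assumes "(v1, v2) \<in> near_normals A B xbar \<delta>" "s \<ge> 0" "t \<ge> 0"
  shows "(s *\<^sub>R v1, t *\<^sub>R v2) \<in> near_normals A B xbar \<delta>"
proof -
  have "c < cosine (r *\<^sub>R v) w" if "c < cosine v w" "r \<ge> 0" for c r and v w :: 'a
    using that cosine_scaleR_ge less_le_trans by blast
  then show ?thesis using assms(1) frechet_normal_cone_scaleR assms(2,3)
    unfolding near_normals_def mem_Collect_eq case_prod_conv by meson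
qed

lemma itr_values_eq_near_normals:
  "itr_values A B xbar \<delta> = {norm (v1 + v2) | v1 v2.
     (v1, v2) \<in> near_normals A B xbar \<delta> \<and> v1 \<noteq> 0 \<and> v2 \<noteq> 0 \<and> norm v1 + norm v2 = 1}"
proof -
  have q: "quot1 (inner v w) (norm v * norm w) = inner v w / (norm v * norm w)"
    if "v \<noteq> 0" "w \<noteq> 0" for v w :: 'a
    using that by (simp add: quot1_def)
  have "r \<in> itr_values A B xbar \<delta> \<longleftrightarrow> (\<exists>v1 v2. r = norm (v1 + v2) \<and>
     (v1, v2) \<in> near_normals A B xbar \<delta> \<and> v1 \<noteq> 0 \<and> v2 \<noteq> 0 \<and> norm v1 + norm v2 = 1)" for r
    unfolding itr_values_def near_normals_def cosine_def mem_Collect_eq case_prod_conv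
    by ((rule ex_cong1)+, safe; (intro exI conjI)?) (auto simp: q abs_less_iff)
  then show ?thesis by auto
qed

text \<open>Sequences are traded for a condition on each scale \<open>\<delta>\<close>, which is the form in which \<open>itr\<close> is
  given and from which closedness is immediate.\<close>

lemma rel_limiting_normals_iff_near:
  "(v1, v2) \<in> rel_limiting_normals A B xbar \<longleftrightarrow>
     (\<forall>\<delta>>0. \<exists>u1\<in>ball v1 \<delta>. \<exists>u2\<in>ball v2 \<delta>. (u1, u2) \<in> near_normals A B xbar \<delta>)"
proof
  assume "(v1, v2) \<in> rel_limiting_normals A B xbar"
  then obtain a b x u1 u2 where
    mem: "\<And>k. a k \<in> A - B \<and> b k \<in> B - A \<and> x k \<noteq> a k \<and> x k \<noteq> b k \<and>
             u1 k \<in> frechet_normal_cone A (a k) \<and> u2 k \<in> frechet_normal_cone B (b k)" and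
    lims: "a \<longlonglongrightarrow> xbar" "b \<longlonglongrightarrow> xbar" "x \<longlonglongrightarrow> xbar" "u1 \<longlonglongrightarrow> v1" "u2 \<longlonglongrightarrow> v2"
      "(\<lambda>k. quot1 (norm (x k - a k)) (norm (x k - b k))) \<longlonglongrightarrow> 1"
      "(\<lambda>k. cosine (u1 k) (x k - a k)) \<longlonglongrightarrow> 1"
      "(\<lambda>k. cosine (u2 k) (x k - b k)) \<longlonglongrightarrow> 1"
    unfolding rel_limiting_normals_def mem_Collect_eq case_prod_conv cosine_def by blast
  show "\<forall>\<delta>>0. \<exists>u1\<in>ball v1 \<delta>. \<exists>u2\<in>ball v2 \<delta>. (u1, u2) \<in> near_normals A B xbar \<delta>"
  proof (intro allI impI)
    fix \<delta> :: real assume "\<delta> > 0"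
    note d = lims[THEN tendstoD, OF this]
    have "\<forall>\<^sub>F k in sequentially. \<exists>u1\<in>ball v1 \<delta>. \<exists>u2\<in>ball v2 \<delta>. (u1, u2) \<in> near_normals A B xbar \<delta>"
      using d
    proof eventually_elim
      case (elim k)
      then have "(u1 k, u2 k) \<in> near_normals A B xbar \<delta>"
        using mem[of k] unfolding near_normals_def mem_Collect_eq case_prod_conv
        by (intro exI[of _ "a k"] exI[of _ "b k"] exI[of _ "x k"])
          (auto simp: dist_commute dist_real_def quot1_def)
      moreover have "u1 k \<in> ball v1 \<delta>" "u2 k \<in> ball v2 \<delta>"
        using elim by (auto simp: dist_commute)
      ultimately show ?case by blast
    qed
    then show "\<exists>u1\<in>ball v1 \<delta>. \<exists>u2\<in>ball v2 \<delta>. (u1, u2) \<in> near_normals A B xbar \<delta>"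
      using eventually_happens' sequentially_bot by blast
  qed
next
  let ?d = "\<lambda>k. inverse (real (Suc k))"
  assume "\<forall>\<delta>>0. \<exists>u1\<in>ball v1 \<delta>. \<exists>u2\<in>ball v2 \<delta>. (u1, u2) \<in> near_normals A B xbar \<delta>"
  then have "\<forall>k. \<exists>u1\<in>ball v1 (?d k). \<exists>u2\<in>ball v2 (?d k). (u1, u2) \<in> near_normals A B xbar (?d k)"
    by simp
  then obtain u1 u2 where u: "\<And>k. u1 k \<in> ball v1 (?d k)" "\<And>k. u2 k \<in> ball v2 (?d k)"
    "\<And>k. (u1 k, u2 k) \<in> near_normals A B xbar (?d k)"
    by metis
  have "\<forall>k. \<exists>a b x.
     a \<in> (A - B) \<inter> ball xbar (?d k) \<and> b \<in> (B - A) \<inter> ball xbar (?d k) \<and> x \<in> ball xbar (?d k) \<and>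
     x \<noteq> a \<and> x \<noteq> b \<and> \<bar>norm (x - a) / norm (x - b) - 1\<bar> < ?d k \<and>
     u1 k \<in> frechet_normal_cone A a \<and> u2 k \<in> frechet_normal_cone B b \<and>
     1 - ?d k < cosine (u1 k) (x - a) \<and> 1 - ?d k < cosine (u2 k) (x - b)"
    using u(3) unfolding near_normals_def by blast
  then obtain a b x where ab: "\<And>k.
     a k \<in> (A - B) \<inter> ball xbar (?d k) \<and> b k \<in> (B - A) \<inter> ball xbar (?d k) \<and> x k \<in> ball xbar (?d k) \<and>
     x k \<noteq> a k \<and> x k \<noteq> b k \<and> \<bar>norm (x k - a k) / norm (x k - b k) - 1\<bar> < ?d k \<and>
     u1 k \<in> frechet_normal_cone A (a k) \<and> u2 k \<in> frechet_normal_cone B (b k) \<and>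
     1 - ?d k < cosine (u1 k) (x k - a k) \<and> 1 - ?d k < cosine (u2 k) (x k - b k)"
    by metis
  have lim: "f \<longlonglongrightarrow> l" if "\<And>k. dist (f k) l < ?d k" for f :: "nat \<Rightarrow> 'b::metric_space" and l
    unfolding tendsto_dist_iff[of f l]
    by (rule tendsto_sandwich[OF _ _ tendsto_const LIMSEQ_inverse_real_of_nat])
      (auto intro!: always_eventually less_imp_le that simp del: of_nat_Suc)
  show "(v1, v2) \<in> rel_limiting_normals A B xbar"
    unfolding rel_limiting_normals_def mem_Collect_eq case_prod_conv cosine_def[symmetric]
  proof (intro exI conjI allI)
    fix k
    show "a k \<in> A - B" "b k \<in> B - A" "x k \<noteq> a k" "x k \<noteq> b k"
      "u1 k \<in> frechet_normal_cone A (a k)" "u2 k \<in> frechet_normal_cone B (b k)"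
      using ab[of k] by auto
  next
    show "a \<longlonglongrightarrow> xbar" "b \<longlonglongrightarrow> xbar" "x \<longlonglongrightarrow> xbar" "u1 \<longlonglongrightarrow> v1" "u2 \<longlonglongrightarrow> v2"
      using ab u(1,2) by (auto intro!: lim simp: dist_commute)
    show "(\<lambda>k. quot1 (norm (x k - a k)) (norm (x k - b k))) \<longlonglongrightarrow> 1"
      using ab by (auto intro!: lim simp: quot1_def dist_real_def)
    have "\<bar>cosine v w - 1\<bar> < e" if "1 - e < cosine v w" for v w :: 'a and e
      using cosine_le_1[of v w] that by linarith
    then show "(\<lambda>k. cosine (u1 k) (x k - a k)) \<longlonglongrightarrow> 1" "(\<lambda>k. cosine (u2 k) (x k - b k)) \<longlonglongrightarrow> 1"
      using ab by (auto intro!: lim simp: dist_real_def)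
  qed
qed

text \<open>Scale \<open>\<delta>\<close> is reached in two steps of \<open>\<delta> / 2\<close>: from the given point to a limiting pair, and from
  there to near normals.\<close>

lemma closed_rel_limiting_normals: "closed (rel_limiting_normals A B xbar)"
proof (rule closure_subset_eq[THEN iffD1], clarify)
  fix v1 v2
  assume "(v1, v2) \<in> closure (rel_limiting_normals A B xbar)"
  then have *: "\<And>e. e > 0 \<Longrightarrow> \<exists>y\<in>rel_limiting_normals A B xbar. dist y (v1, v2) < e"
    by (simp add: closure_approachable)
  show "(v1, v2) \<in> rel_limiting_normals A B xbar"
    unfolding rel_limiting_normals_iff_near
  proof (intro allI impI)
    fix \<delta> :: real assume "\<delta> > 0"
    then have h: "\<delta> / 2 > 0" by simp
    obtain w1 w2 where w: "(w1, w2) \<in> rel_limiting_normals A B xbar"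
      "dist (w1, w2) (v1, v2) < \<delta> / 2" using *[OF h] by auto
    then obtain u1 u2 where u: "u1 \<in> ball w1 (\<delta> / 2)" "u2 \<in> ball w2 (\<delta> / 2)"
      "(u1, u2) \<in> near_normals A B xbar (\<delta> / 2)"
      using h rel_limiting_normals_iff_near by blast
    have "dist w1 v1 < \<delta> / 2" "dist w2 v2 < \<delta> / 2"
      using w(2) dist_fst_le[of "(w1, w2)" "(v1, v2)"] dist_snd_le[of "(w1, w2)" "(v1, v2)"]
      by auto
    then have "u1 \<in> ball v1 \<delta>" "u2 \<in> ball v2 \<delta>"
      using u(1,2) dist_triangle_half_r[of w1 v1 \<delta> u1] dist_triangle_half_r[of w2 v2 \<delta> u2]
      by auto
    moreover have "(u1, u2) \<in> near_normals A B xbar \<delta>"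
      using near_normals_mono[of "\<delta> / 2" \<delta>] h u(3) by auto
    ultimately show "\<exists>u1\<in>ball v1 \<delta>. \<exists>u2\<in>ball v2 \<delta>. (u1, u2) \<in> near_normals A B xbar \<delta>"
      by blast
  qed
qed

section \<open>Intrinsic transversality through unit normals\<close>

lemma itr_inf_le_1: "itr_inf A B xbar \<delta> \<le> 1"
proof (cases "itr_values A B xbar \<delta> = {}")
  case False
  then obtain v1 v2 :: 'a
    where v: "norm (v1 + v2) \<in> itr_values A B xbar \<delta>" "norm v1 + norm v2 = 1"
    by (fastforce simp: itr_values_eq_near_normals)
  have "bdd_below (itr_values A B xbar \<delta>)"
    by (rule bdd_belowI[of _ 0]) (auto simp: itr_values_eq_near_normals)
  then have "Inf (itr_values A B xbar \<delta>) \<le> norm (v1 + v2)" using v(1) by (rule cInf_lower[rotated])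
  also have "\<dots> \<le> 1" using norm_triangle_ineq[of v1 v2] v(2) by simp
  finally show ?thesis using False by (simp add: itr_inf_def)
qed (simp add: itr_inf_def)

lemma itr_inf_nonneg: "0 \<le> itr_inf A B xbar \<delta>"
  by (auto simp: itr_inf_def itr_values_eq_near_normals intro!: cInf_greatest)

lemma itr_inf_le:
  assumes "r \<in> itr_values A B xbar \<delta>"
  shows "itr_inf A B xbar \<delta> \<le> r"
proof -
  have "bdd_below (itr_values A B xbar \<delta>)"
    by (rule bdd_belowI[of _ 0]) (auto simp: itr_values_eq_near_normals)
  then show ?thesis using assms by (auto simp: itr_inf_def intro: cInf_lower)
qed

lemma itr_inf_antimono:
  assumes "\<delta> \<le> \<epsilon>"
  shows "itr_inf A B xbar \<epsilon> \<le> itr_inf A B xbar \<delta>"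
proof (cases "itr_values A B xbar \<delta> = {}")
  case True
  then show ?thesis using itr_inf_le_1 by (simp add: itr_inf_def[of _ _ _ \<delta>])
next
  case False
  have "itr_values A B xbar \<delta> \<subseteq> itr_values A B xbar \<epsilon>"
    unfolding itr_values_eq_near_normals using near_normals_mono[OF assms] by blast
  then have "itr_inf A B xbar \<epsilon> \<le> Inf (itr_values A B xbar \<delta>)"
    using False itr_inf_le by (intro cInf_greatest) blast+
  then show ?thesis using False by (simp add: itr_inf_def[of _ _ _ \<delta>])
qed

text \<open>The limit exists because \<open>I(\<delta>)\<close> grows as \<open>\<delta>\<close> decreases and stays below \<open>1\<close>; the value \<open>1\<close> for
  the empty infimum respects both properties.\<close>

lemma itr_eq_Sup: "itr A B xbar = (SUP \<delta>\<in>{0<..}. itr_inf A B xbar \<delta>)"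
proof -
  let ?L = "SUP \<delta>\<in>{0<..}. itr_inf A B xbar \<delta>"
  have bdd: "bdd_above (itr_inf A B xbar ` {0<..})"
    using itr_inf_le_1 by (intro bdd_aboveI[of _ 1]) auto
  have "(itr_inf A B xbar \<longlongrightarrow> ?L) (at_right 0)"
  proof (rule order_tendstoI)
    fix c assume "c < ?L"
    then obtain \<epsilon> where \<epsilon>: "\<epsilon> > 0" "c < itr_inf A B xbar \<epsilon>"
      using less_cSUP_iff[OF _ bdd] by auto
    have "\<forall>\<^sub>F \<delta> in at_right 0. \<delta> < \<epsilon>"
      using \<epsilon>(1) by (auto simp: eventually_at_right_field)
    then show "\<forall>\<^sub>F \<delta> in at_right 0. c < itr_inf A B xbar \<delta>"
      by eventually_elim (use \<epsilon>(2) itr_inf_antimono less_le_trans less_imp_le in blast)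
  next
    fix c assume c: "?L < c"
    have "\<forall>\<^sub>F \<delta> in at_right (0::real). \<delta> > 0" by (rule eventually_at_right_less)
    then show "\<forall>\<^sub>F \<delta> in at_right 0. itr_inf A B xbar \<delta> < c"
      by eventually_elim (use c cSUP_upper[OF _ bdd] in \<open>auto intro: le_less_trans\<close>)
  qed
  then show ?thesis by (simp add: itr_def tendsto_Lim)
qed

lemma itr_inf_le_itr:
  assumes "\<delta> > 0"
  shows "itr_inf A B xbar \<delta> \<le> itr A B xbar"
  unfolding itr_eq_Sup using assms itr_inf_le_1
  by (intro cSUP_upper bdd_aboveI[of _ 1]) auto

lemma itr_le:
  assumes "\<And>\<delta>. \<delta> > 0 \<Longrightarrow> itr_inf A B xbar \<delta> \<le> c"
  shows "itr A B xbar \<le> c"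
  unfolding itr_eq_Sup using assms by (intro cSUP_least) auto

lemma itr_nonneg: "0 \<le> itr A B xbar"
  using order.trans[OF itr_inf_nonneg itr_inf_le_itr[of 1 A B xbar]] by simp

lemma itr_le_1: "itr A B xbar \<le> 1"
  using itr_inf_le_1 by (rule itr_le)

definition unit_rel_normals :: "'a::euclidean_space set \<Rightarrow> 'a set \<Rightarrow> 'a \<Rightarrow> ('a \<times> 'a) set" where
  "unit_rel_normals A B xbar =
     {(v1, v2) \<in> rel_limiting_normals A B xbar. norm v1 = 1 \<and> norm v2 = 1}"

text \<open>The midpoint of a segment between unit vectors is its shortest vector: with \<open>s + t = 1\<close> and
  \<open>c = inner w1 w2\<close>, the square of \<open>norm (s w1 + t w2)\<close> is \<open>1 - 2 s t (1 - c)\<close>, and \<open>s t\<close> is at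
  most \<open>1/4\<close>.\<close>

lemma norm_midpoint_le:
  fixes v1 v2 :: "'a::real_inner"
  assumes "v1 \<noteq> 0" "v2 \<noteq> 0" "norm v1 + norm v2 = 1"
  shows "norm (sgn v1 + sgn v2) / 2 \<le> norm (v1 + v2)"
proof -
  define w1 w2 s t where "w1 = sgn v1" "w2 = sgn v2" "s = norm v1" "t = norm v2"
  note defs = this
  have v: "v1 = s *\<^sub>R w1" "v2 = t *\<^sub>R w2" and n: "norm w1 = 1" "norm w2 = 1" and t: "t = 1 - s"
    using assms by (auto simp: defs sgn_div_norm norm_sgn)
  define c where "c = inner w1 w2"
  have c: "c \<le> 1" using norm_cauchy_schwarz[of w1 w2] n by (simp add: c_def)
  have ii: "inner w1 w1 = 1" "inner w2 w2 = 1" using n by (simp_all add: norm_eq_1)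
  have "(norm (w1 + w2))\<^sup>2 = 2 + 2 * c"
    by (simp add: power2_norm_eq_inner inner_add inner_commute ii c_def)
  then have l: "(norm (w1 + w2) / 2)\<^sup>2 = (1 + c) / 2" by (simp add: power_divide)
  have r: "(norm (v1 + v2))\<^sup>2 = s * s + t * t + 2 * s * t * c"
    unfolding v by (simp add: power2_norm_eq_inner inner_add inner_commute ii c_def)
  have "0 \<le> (2 * s - 1)\<^sup>2 * (1 - c)" using c by simp
  then have "(norm (w1 + w2) / 2)\<^sup>2 \<le> (norm (v1 + v2))\<^sup>2"
    unfolding l r t by (simp add: power2_eq_square field_simps)
  then show ?thesis unfolding defs by (rule power2_le_imp_le) simp
qed

text \<open>Near normals \<open>u1\<close>, \<open>u2\<close> that approximate a unit pair need not satisfy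
  \<open>norm u1 + norm u2 = 1\<close>. Rescaled to norm \<open>1/2\<close> they do, and by continuity of the rescaling
  the norm of their sum is still close to \<open>norm (w1 + w2) / 2\<close>.\<close>

lemma itr_le_unit_rel_normals:
  assumes "(w1, w2) \<in> unit_rel_normals A B xbar"
  shows "\<delta> > 0 \<Longrightarrow> itr_values A B xbar \<delta> \<noteq> {}"
    and "2 * itr A B xbar \<le> norm (w1 + w2)"
proof -
  have w: "(w1, w2) \<in> rel_limiting_normals A B xbar" "norm w1 = 1" "norm w2 = 1"
    using assms by (auto simp: unit_rel_normals_def)
  have near: "\<exists>r\<in>itr_values A B xbar \<delta>. r < norm (w1 + w2) / 2 + e" if "\<delta> > 0" "e > 0" for \<delta> e
  proof -
    define f where "f p = norm (sgn (fst p) + sgn (snd p)) / 2" for p :: "'a \<times> 'a"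
    have "isCont f (w1, w2)"
      unfolding f_def sgn_div_norm using w by (intro continuous_intros) auto
    then obtain h where h: "h > 0" "\<And>p. dist p (w1, w2) < h \<Longrightarrow> dist (f p) (f (w1, w2)) < e"
      using \<open>e > 0\<close> unfolding continuous_at_eps_delta by blast
    define \<eta> where "\<eta> = min \<delta> (min (h / 2) 1)"
    have \<eta>: "\<eta> > 0" "\<eta> \<le> \<delta>" "\<eta> \<le> h / 2" "\<eta> \<le> 1" using h \<open>\<delta> > 0\<close> by (auto simp: \<eta>_def)
    obtain u1 u2 where u: "u1 \<in> ball w1 \<eta>" "u2 \<in> ball w2 \<eta>" "(u1, u2) \<in> near_normals A B xbar \<eta>"
      using w(1) \<eta>(1) rel_limiting_normals_iff_near by blast
    have nz: "u1 \<noteq> 0" "u2 \<noteq> 0" using u(1,2) w \<eta>(4) by (auto simp: dist_norm)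
    let ?v1 = "(1 / (2 * norm u1)) *\<^sub>R u1" and ?v2 = "(1 / (2 * norm u2)) *\<^sub>R u2"
    have "(?v1, ?v2) \<in> near_normals A B xbar \<delta>"
      using u(3) near_normals_mono[OF \<eta>(2)] by (intro near_normals_scaleR) auto
    moreover have "norm ?v1 + norm ?v2 = 1" "?v1 \<noteq> 0" "?v2 \<noteq> 0" using nz by auto
    ultimately have "norm (?v1 + ?v2) \<in> itr_values A B xbar \<delta>"
      unfolding itr_values_eq_near_normals by blast
    moreover have "?v1 + ?v2 = (1 / 2) *\<^sub>R (sgn u1 + sgn u2)"
      by (simp add: sgn_div_norm scaleR_add_right inverse_eq_divide)
    then have "norm (?v1 + ?v2) = f (u1, u2)" by (simp add: f_def)
    moreover have "dist (u1, u2) (w1, w2) \<le> dist u1 w1 + dist u2 w2"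
      unfolding dist_Pair_Pair by (rule sqrt_sum_squares_le_sum) auto
    then have "dist (u1, u2) (w1, w2) < h"
      using u(1,2) \<eta>(3) by (simp add: dist_commute)
    then have "f (u1, u2) < f (w1, w2) + e" using h(2) by (fastforce simp: dist_real_def)
    moreover have "f (w1, w2) = norm (w1 + w2) / 2" using w by (simp add: f_def sgn_div_norm)
    ultimately show ?thesis by metis
  qed
  show "\<delta> > 0 \<Longrightarrow> itr_values A B xbar \<delta> \<noteq> {}" using near[of \<delta> 1] by auto
  have "itr_inf A B xbar \<delta> \<le> norm (w1 + w2) / 2" if "\<delta> > 0" for \<delta>
    by (rule field_le_epsilon) (use near[OF that] itr_inf_le in \<open>fastforce intro: order.trans\<close>)
  then have "itr A B xbar \<le> norm (w1 + w2) / 2" by (rule itr_le)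
  then show "2 * itr A B xbar \<le> norm (w1 + w2)" by simp
qed

text \<open>Near minimisers of \<open>I(\<delta>)\<close> are replaced by their directions before a convergent subsequence is
  chosen: one of the two vectors may tend to zero, and then their own limit would not yield a unit
  pair.\<close>

lemma itr_attained:
  assumes "\<And>\<delta>. \<delta> > 0 \<Longrightarrow> itr_values A B xbar \<delta> \<noteq> {}"
  shows "\<exists>(w1, w2)\<in>unit_rel_normals A B xbar. norm (w1 + w2) \<le> 2 * itr A B xbar"
proof -
  let ?d = "\<lambda>k. inverse (real (Suc k))"
  have "\<exists>p. fst p \<in> sphere 0 1 \<and> snd p \<in> sphere 0 1 \<and> p \<in> near_normals A B xbar (?d k) \<and>
      norm (fst p + snd p) / 2 \<le> itr A B xbar + ?d k" for k
  proof -
    have ne: "itr_values A B xbar (?d k) \<noteq> {}" using assms by simp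
    moreover have "Inf (itr_values A B xbar (?d k)) < itr A B xbar + ?d k"
      using itr_inf_le_itr[of "?d k" A B xbar] ne by (simp add: itr_inf_def)
        (metis add_le_less_mono add.right_neutral inverse_positive_iff_positive of_nat_0_less_iff
          of_nat_Suc zero_less_Suc)
    ultimately obtain r where r: "r \<in> itr_values A B xbar (?d k)" "r < itr A B xbar + ?d k"
      using cInf_lessD by blast
    then obtain v1 v2 where v: "r = norm (v1 + v2)" "(v1, v2) \<in> near_normals A B xbar (?d k)"
      "v1 \<noteq> 0" "v2 \<noteq> 0" "norm v1 + norm v2 = 1"
      unfolding itr_values_eq_near_normals by blast
    have "(sgn v1, sgn v2) \<in> near_normals A B xbar (?d k)"
      unfolding sgn_div_norm using v(2) by (intro near_normals_scaleR) auto
    moreover have "norm (sgn v1 + sgn v2) / 2 \<le> itr A B xbar + ?d k"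
      using norm_midpoint_le[OF v(3-5)] r(2) v(1) by simp
    ultimately show ?thesis using v(3,4)
      by (intro exI[of _ "(sgn v1, sgn v2)"]) (simp add: norm_sgn)
  qed
  then obtain p where p: "\<And>k. p k \<in> sphere 0 1 \<times> sphere 0 1"
      "\<And>k. p k \<in> near_normals A B xbar (?d k)"
      "\<And>k. norm (fst (p k) + snd (p k)) / 2 \<le> itr A B xbar + ?d k"
    by (metis mem_Times_iff)
  have "compact (sphere (0::'a) 1 \<times> sphere (0::'a) 1)"
    by (intro compact_Times compact_sphere)
  then obtain w \<sigma> where w: "w \<in> sphere (0::'a) 1 \<times> sphere (0::'a) 1" "strict_mono \<sigma>"
    "(p \<circ> \<sigma>) \<longlonglongrightarrow> w"
    using p(1) unfolding compact_def by metis
  obtain w1 w2 where w12: "w = (w1, w2)" by fastforce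
  have d0: "(\<lambda>k. ?d (\<sigma> k)) \<longlonglongrightarrow> 0"
    using LIMSEQ_subseq_LIMSEQ[OF LIMSEQ_inverse_real_of_nat w(2)] by (simp add: o_def)
  have "(w1, w2) \<in> rel_limiting_normals A B xbar"
    unfolding rel_limiting_normals_iff_near
  proof (intro allI impI)
    fix \<delta> :: real assume \<delta>: "\<delta> > 0"
    have "\<forall>\<^sub>F k in sequentially. dist ((p \<circ> \<sigma>) k) w < \<delta> \<and> ?d (\<sigma> k) < \<delta>"
      using tendstoD[OF w(3) \<delta>] order_tendstoD(2)[OF d0 \<delta>] by (rule eventually_conj)
    then obtain k where k: "dist (p (\<sigma> k)) w < \<delta>" "?d (\<sigma> k) < \<delta>"
      using eventually_happens' sequentially_bot by (metis (mono_tags, lifting) o_apply)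
    have "(fst (p (\<sigma> k)), snd (p (\<sigma> k))) \<in> near_normals A B xbar \<delta>"
      using p(2)[of "\<sigma> k"] near_normals_mono[of "?d (\<sigma> k)" \<delta>] k(2) by auto
    moreover have "fst (p (\<sigma> k)) \<in> ball w1 \<delta>" "snd (p (\<sigma> k)) \<in> ball w2 \<delta>"
      using k(1) dist_fst_le[of "p (\<sigma> k)" w] dist_snd_le[of "p (\<sigma> k)" w]
      by (auto simp: w12 dist_commute)
    ultimately show "\<exists>u1\<in>ball w1 \<delta>. \<exists>u2\<in>ball w2 \<delta>. (u1, u2) \<in> near_normals A B xbar \<delta>" by blast
  qed
  then have mem: "(w1, w2) \<in> unit_rel_normals A B xbar"
    using w(1) by (simp add: unit_rel_normals_def w12)
  have "(\<lambda>k. norm (fst ((p \<circ> \<sigma>) k) + snd ((p \<circ> \<sigma>) k)) / 2) \<longlonglongrightarrow> norm (fst w + snd w) / 2"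
    by (intro tendsto_intros w(3)) simp
  moreover have "(\<lambda>k. itr A B xbar + ?d (\<sigma> k)) \<longlonglongrightarrow> itr A B xbar + 0"
    by (intro tendsto_intros d0)
  ultimately have "norm (fst w + snd w) / 2 \<le> itr A B xbar + 0"
    by (rule LIMSEQ_le) (use p(3) in auto)
  then show ?thesis using mem w12 by (intro bexI[of _ "(w1, w2)"]) auto
qed

lemma itr_eq_1_if_no_unit_rel_normals:
  assumes "unit_rel_normals A B xbar = {}"
  shows "itr A B xbar = 1"
proof -
  obtain \<delta> where \<delta>: "\<delta> > 0" "itr_values A B xbar \<delta> = {}"
    using itr_attained[of A B xbar] assms by auto
  then have "1 \<le> itr A B xbar" using itr_inf_le_itr[OF \<delta>(1), of A B xbar] by (simp add: itr_inf_def)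
  then show ?thesis using itr_le_1 antisym by blast
qed

text \<open>Together with \<open>itr_le_unit_rel_normals\<close> this makes \<open>2 itr\<close> the minimum of \<open>norm (v1 + v2)\<close>
  over the unit pairs.\<close>

lemma two_itr_attained:
  assumes "unit_rel_normals A B xbar \<noteq> {}"
  obtains w1 w2 where "(w1, w2) \<in> unit_rel_normals A B xbar" "norm (w1 + w2) = 2 * itr A B xbar"
proof -
  obtain u1 u2 where u: "(u1, u2) \<in> unit_rel_normals A B xbar" using assms by auto
  have "\<exists>(w1, w2)\<in>unit_rel_normals A B xbar. norm (w1 + w2) \<le> 2 * itr A B xbar"
    by (rule itr_attained) (rule itr_le_unit_rel_normals(1)[OF u])
  then obtain w1 w2 where
    w: "(w1, w2) \<in> unit_rel_normals A B xbar" "norm (w1 + w2) \<le> 2 * itr A B xbar" by blast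
  with that itr_le_unit_rel_normals(2)[OF w(1)] show ?thesis by simp
qed

section \<open>The other constants\<close>

lemma norm_add_diff_unit:
  fixes v1 v2 :: "'a::real_inner"
  assumes "norm v1 = 1" "norm v2 = 1"
  shows "(norm (v1 + v2))\<^sup>2 = 2 + 2 * inner v1 v2" "(norm (v1 - v2))\<^sup>2 = 2 - 2 * inner v1 v2"
  using assms
  by (simp_all add: power2_norm_eq_inner inner_add inner_diff inner_commute norm_eq_1)

lemma norm_add_le_iff_inner_le:
  fixes v1 v2 w1 w2 :: "'a::real_inner"
  assumes "norm v1 = 1" "norm v2 = 1" "norm w1 = 1" "norm w2 = 1"
  shows "norm (w1 + w2) \<le> norm (v1 + v2) \<longleftrightarrow> inner w1 w2 \<le> inner v1 v2"
    and "norm (v1 - v2) \<le> norm (w1 - w2) \<longleftrightarrow> inner w1 w2 \<le> inner v1 v2"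
  using norm_add_diff_unit[OF assms(1,2)] norm_add_diff_unit[OF assms(3,4)]
    power_mono_iff[of "norm (w1 + w2)" "norm (v1 + v2)" 2]
    power_mono_iff[of "norm (v1 - v2)" "norm (w1 - w2)" 2]
  by simp_all

text \<open>For unit vectors \<open>norm (v1 + v2)\<close>, \<open>norm (v1 - v2)\<close> and \<open>inner v1 v2\<close> are monotone functions
  of one another, so one and the same pair realises \<open>itr\<close>, \<open>itr1\<close> and \<open>itr2\<close>.\<close>

lemma common_extremal_pair:
  assumes "unit_rel_normals A B xbar \<noteq> {}"
  shows "\<exists>w1 w2. (w1, w2) \<in> unit_rel_normals A B xbar \<and> norm w1 = 1 \<and> norm w2 = 1 \<and>
    norm (w1 + w2) = 2 * itr A B xbar \<and> itr1 A B xbar = norm (w1 - w2) \<and>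
    itr2 A B xbar = - inner w1 w2 \<and>
    (\<forall>v1 v2. (v1, v2) \<in> unit_rel_normals A B xbar \<longrightarrow>
      norm (v1 - v2) \<le> norm (w1 - w2) \<and> inner w1 w2 \<le> inner v1 v2)"
proof -
  obtain w1 w2 where w: "(w1, w2) \<in> unit_rel_normals A B xbar" "norm (w1 + w2) = 2 * itr A B xbar"
    using two_itr_attained[OF assms] .
  have n: "norm v1 = 1" "norm v2 = 1" if "(v1, v2) \<in> unit_rel_normals A B xbar" for v1 v2
    using that by (auto simp: unit_rel_normals_def)
  have inner_min: "inner w1 w2 \<le> inner v1 v2" if "(v1, v2) \<in> unit_rel_normals A B xbar" for v1 v2
    using norm_add_le_iff_inner_le(1)[OF n[OF that] n[OF w(1)]] itr_le_unit_rel_normals(2)[OF that]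
      w(2) by simp
  then have diff_max: "norm (v1 - v2) \<le> norm (w1 - w2)"
    if "(v1, v2) \<in> unit_rel_normals A B xbar" for v1 v2
    using norm_add_le_iff_inner_le(2)[OF n[OF that] n[OF w(1)]] that by simp
  have sets: "{f v1 v2 | v1 v2.
      (v1, v2) \<in> rel_limiting_normals A B xbar \<and> norm v1 = 1 \<and> norm v2 = 1}
      = {f v1 v2 | v1 v2. (v1, v2) \<in> unit_rel_normals A B xbar}" for f :: "'a \<Rightarrow> 'a \<Rightarrow> real"
    by (simp add: unit_rel_normals_def)
  have "(GREATEST r. r \<in> {norm (v1 - v2) | v1 v2. (v1, v2) \<in> unit_rel_normals A B xbar})
      = norm (w1 - w2)"
    using w(1) diff_max by (intro Greatest_equality) auto
  then have 1: "itr1 A B xbar = norm (w1 - w2)"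
    using w(1) unfolding itr1_def sets max_or_def by auto
  have "(LEAST r. r \<in> {inner v1 v2 | v1 v2. (v1, v2) \<in> unit_rel_normals A B xbar}) = inner w1 w2"
    using w(1) inner_min by (intro Least_equality) auto
  then have 2: "itr2 A B xbar = - inner w1 w2"
    using w(1) unfolding itr2_def sets min_or_def by auto
  show ?thesis using w n[OF w(1)] 1 2 diff_max inner_min by blast
qed

lemma itr1_itr2_if_no_unit_rel_normals:
  assumes "unit_rel_normals A B xbar = {}"
  shows "itr1 A B xbar = 0" "itr2 A B xbar = - 1"
proof -
  have "{f v1 v2 | v1 v2.
      (v1, v2) \<in> rel_limiting_normals A B xbar \<and> norm v1 = 1 \<and> norm v2 = 1} = {}"
    for f :: "'a \<Rightarrow> 'a \<Rightarrow> real"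
    using assms by (auto simp: unit_rel_normals_def)
  then show "itr1 A B xbar = 0" "itr2 A B xbar = - 1"
    by (simp_all only: itr1_def itr2_def max_or_def min_or_def simp_thms if_True)
qed

text \<open>The bound \<open>\<alpha> < 2\<close> matters when there are no unit pairs: the left side is then vacuous and
  \<open>2 * itr A B xbar = 2\<close>.\<close>

lemma lower_bound_norm_add_iff:
  assumes "\<alpha> < 2"
  shows "(\<forall>(v1, v2)\<in>unit_rel_normals A B xbar. \<alpha> < norm (v1 + v2)) \<longleftrightarrow> \<alpha> < 2 * itr A B xbar"
proof (cases "unit_rel_normals A B xbar = {}")
  case True
  then show ?thesis using assms itr_eq_1_if_no_unit_rel_normals[OF True] by simp
next
  case False
  then obtain w1 w2 where "(w1, w2) \<in> unit_rel_normals A B xbar" "norm (w1 + w2) = 2 * itr A B xbar"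
    by (rule two_itr_attained)
  then show ?thesis using itr_le_unit_rel_normals(2) by (fastforce intro: less_le_trans)
qed

text \<open>The values \<open>1\<close>, \<open>0\<close> and \<open>- 1\<close> that \<open>itr\<close>, \<open>itr1\<close> and \<open>itr2\<close> take when there are no unit pairs
  satisfy the same two equations.\<close>

lemma itr1_itr2_eq:
  shows itr1_eq: "itr1 A B xbar = 2 * sqrt (1 - (itr A B xbar)\<^sup>2)"
    and itr2_eq: "itr2 A B xbar = 1 - 2 * (itr A B xbar)\<^sup>2"
proof -
  have "(itr1 A B xbar)\<^sup>2 + (2 * itr A B xbar)\<^sup>2 = 4 \<and> 0 \<le> itr1 A B xbar \<and>
      (2 * itr A B xbar)\<^sup>2 = 2 - 2 * itr2 A B xbar"
  proof (cases "unit_rel_normals A B xbar = {}")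
    case True
    then show ?thesis
      using itr1_itr2_if_no_unit_rel_normals[OF True] itr_eq_1_if_no_unit_rel_normals[OF True]
      by simp
  next
    case False
    then obtain w1 w2 where w: "norm w1 = 1" "norm w2 = 1"
      "(w1, w2) \<in> unit_rel_normals A B xbar"
      "norm (w1 + w2) = 2 * itr A B xbar" "itr1 A B xbar = norm (w1 - w2)"
      "itr2 A B xbar = - inner w1 w2"
      using common_extremal_pair[OF False] by blast
    show ?thesis using norm_add_diff_unit[OF w(1,2)] unfolding w(4-6)[symmetric] by (simp add: w)
  qed
  then have 1: "(itr1 A B xbar)\<^sup>2 = 4 * (1 - (itr A B xbar)\<^sup>2)" and 0: "0 \<le> itr1 A B xbar"
    and 2: "itr2 A B xbar = 1 - 2 * (itr A B xbar)\<^sup>2"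
    by (auto simp: power_mult_distrib)
  have "itr1 A B xbar = sqrt (4 * (1 - (itr A B xbar)\<^sup>2))"
    using 0 unfolding 1[symmetric] by simp
  then show "itr1 A B xbar = 2 * sqrt (1 - (itr A B xbar)\<^sup>2)"
    by (simp only: real_sqrt_mult real_sqrt_four)
  show "itr2 A B xbar = 1 - 2 * (itr A B xbar)\<^sup>2" by (rule 2)
qed

lemma itr_square_le_1: "(itr A B xbar)\<^sup>2 \<le> 1"
  using itr_nonneg itr_le_1 by (rule power_le_one)

lemma itr1_bounds: "0 \<le> itr1 A B xbar" "itr1 A B xbar \<le> 2"
  unfolding itr1_eq using itr_square_le_1 by auto

lemma itr1_less_2_iff: "itr1 A B xbar < 2 \<longleftrightarrow> 0 < itr A B xbar"
  unfolding itr1_eq using itr_nonneg[of A B xbar] by auto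

lemma itr2_bounds: "- 1 \<le> itr2 A B xbar" "itr2 A B xbar \<le> 1"
  unfolding itr2_eq using itr_square_le_1[of A B xbar] by auto

lemma itr2_less_1_iff: "itr2 A B xbar < 1 \<longleftrightarrow> 0 < itr A B xbar"
  unfolding itr2_eq using itr_nonneg[of A B xbar] by auto

lemma upper_bound_norm_diffI:
  assumes "itr1 A B xbar < \<alpha>"
  shows "\<forall>(v1, v2)\<in>unit_rel_normals A B xbar. norm (v1 - v2) < \<alpha>"
proof (cases "unit_rel_normals A B xbar = {}")
  case False
  then obtain w1 w2 where "(w1, w2) \<in> unit_rel_normals A B xbar"
    "itr1 A B xbar = norm (w1 - w2)"
    "\<And>v1 v2. (v1, v2) \<in> unit_rel_normals A B xbar \<Longrightarrow> norm (v1 - v2) \<le> norm (w1 - w2)"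
    using common_extremal_pair[OF False] by blast
  then show ?thesis using assms by (auto intro: le_less_trans)
qed simp

text \<open>The maximum with \<open>0\<close> covers the vacuous case, in which \<open>\<alpha>\<close> may be negative while \<open>itr1\<close> is
  \<open>0\<close>; similarly for \<open>- 1\<close> and \<open>itr2\<close> in \<open>lower_bound_innerD\<close>.\<close>

lemma upper_bound_norm_diffD:
  assumes "\<forall>(v1, v2)\<in>unit_rel_normals A B xbar. norm (v1 - v2) < \<alpha>"
  shows "itr1 A B xbar \<le> max 0 \<alpha>"
proof (cases "unit_rel_normals A B xbar = {}")
  case True
  then show ?thesis by (simp add: itr1_itr2_if_no_unit_rel_normals)
next
  case False
  then obtain w1 w2 where "(w1, w2) \<in> unit_rel_normals A B xbar" "itr1 A B xbar = norm (w1 - w2)"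
    using common_extremal_pair[OF False] by blast
  then show ?thesis using assms by fastforce
qed

lemma lower_bound_innerI:
  assumes "itr2 A B xbar < \<alpha>"
  shows "\<forall>(v1, v2)\<in>unit_rel_normals A B xbar. - \<alpha> < inner v1 v2"
proof (cases "unit_rel_normals A B xbar = {}")
  case False
  obtain w1 w2 where "(w1, w2) \<in> unit_rel_normals A B xbar"
    "itr2 A B xbar = - inner w1 w2"
    "\<And>v1 v2. (v1, v2) \<in> unit_rel_normals A B xbar \<Longrightarrow> inner w1 w2 \<le> inner v1 v2"
    using common_extremal_pair[OF False] by blast
  then show ?thesis using assms by fastforce
qed simp

lemma lower_bound_innerD:
  assumes "\<forall>(v1, v2)\<in>unit_rel_normals A B xbar. - \<alpha> < inner v1 v2"
  shows "itr2 A B xbar \<le> max (- 1) \<alpha>"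
proof (cases "unit_rel_normals A B xbar = {}")
  case True
  then show ?thesis by (simp add: itr1_itr2_if_no_unit_rel_normals)
next
  case False
  then obtain w1 w2 where "(w1, w2) \<in> unit_rel_normals A B xbar" "itr2 A B xbar = - inner w1 w2"
    using common_extremal_pair[OF False] by blast
  then show ?thesis using assms by fastforce
qed

text \<open>The least value in the definition of \<open>itr3\<close> exists because the distance is continuous on the
  compact unit sphere, which is not empty.\<close>

lemma itr3_attained:
  fixes A B :: "'a::euclidean_space set" and xbar :: 'a
  shows "\<exists>v0. norm v0 = 1 \<and>
    itr3 A B xbar = dist_to (v0, - v0) (rel_limiting_normals A B xbar) \<and>
    (\<forall>v. norm v = 1 \<longrightarrow> itr3 A B xbar \<le> dist_to (v, - v) (rel_limiting_normals A B xbar))"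
proof -
  let ?d = "\<lambda>v. dist_to (v, - v) (rel_limiting_normals A B xbar)"
  obtain e :: 'a where "e \<in> Basis" using nonempty_Basis by blast
  then have "sphere (0::'a) 1 \<noteq> {}" by (auto intro!: exI[of _ e])
  moreover have "continuous_on (sphere 0 1) ?d"
    unfolding dist_to_def if_distrib
    by (cases "rel_limiting_normals A B xbar = {}") (simp_all, (intro continuous_intros)+)
  ultimately obtain v0 where v0: "v0 \<in> sphere 0 1" "\<And>v. v \<in> sphere 0 1 \<Longrightarrow> ?d v0 \<le> ?d v"
    using continuous_attains_inf[OF compact_sphere, of 0 1 ?d] by blast
  then have "itr3 A B xbar = ?d v0"
    unfolding itr3_def by (intro Least_equality) auto
  with v0 show ?thesis by (intro exI[of _ v0]) auto
qed

lemma less_itr3_iff: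
  "(\<forall>v. norm v = 1 \<longrightarrow> \<alpha> < dist_to (v, - v) (rel_limiting_normals A B xbar)) \<longleftrightarrow> \<alpha> < itr3 A B xbar"
proof -
  obtain v0 where "norm v0 = 1"
    "itr3 A B xbar = dist_to (v0, - v0) (rel_limiting_normals A B xbar)"
    "\<And>v. norm v = 1 \<Longrightarrow> itr3 A B xbar \<le> dist_to (v, - v) (rel_limiting_normals A B xbar)"
    using itr3_attained[of A B xbar] by blast
  then show ?thesis by (auto intro: less_le_trans)
qed

lemma itr3_nonneg: "0 \<le> itr3 A B xbar"
proof -
  obtain v0 where "itr3 A B xbar = dist_to (v0, - v0) (rel_limiting_normals A B xbar)"
    using itr3_attained[of A B xbar] by blast
  then show ?thesis by (simp add: dist_to_def infdist_nonneg)
qed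

text \<open>Both constants vanish exactly when some \<open>(v, - v)\<close> with \<open>v\<close> of norm one is a pair of
  relative limiting normals; for \<open>itr3\<close> this uses that those pairs form a closed set.\<close>

lemma itr3_pos_iff: "0 < itr3 A B xbar \<longleftrightarrow> 0 < itr A B xbar"
proof
  assume "0 < itr3 A B xbar"
  show "0 < itr A B xbar"
  proof (rule ccontr)
    assume "\<not> 0 < itr A B xbar"
    then have 0: "itr A B xbar = 0" using itr_nonneg[of A B xbar] by simp
    then have "unit_rel_normals A B xbar \<noteq> {}" using itr_eq_1_if_no_unit_rel_normals by force
    then obtain w1 w2 where w: "(w1, w2) \<in> unit_rel_normals A B xbar"
      "norm (w1 + w2) = 2 * itr A B xbar" by (rule two_itr_attained)
    then have "w2 = - w1" using 0 by (simp add: eq_neg_iff_add_eq_0 add.commute)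
    then have "norm w1 = 1" "(w1, - w1) \<in> rel_limiting_normals A B xbar"
      using w(1) by (auto simp: unit_rel_normals_def)
    moreover from this(1) have "0 < dist_to (w1, - w1) (rel_limiting_normals A B xbar)"
      using \<open>0 < itr3 A B xbar\<close> less_itr3_iff by blast
    ultimately show False by (auto simp: dist_to_def split: if_splits)
  qed
next
  assume pos: "0 < itr A B xbar"
  have "0 < dist_to (v, - v) (rel_limiting_normals A B xbar)" if v: "norm v = 1" for v
  proof (cases "rel_limiting_normals A B xbar = {}")
    case True
    then show ?thesis using v by (auto simp: dist_to_def zero_prod_def)
  next
    case False
    have "(v, - v) \<notin> rel_limiting_normals A B xbar"
    proof
      assume "(v, - v) \<in> rel_limiting_normals A B xbar"
      then have "(v, - v) \<in> unit_rel_normals A B xbar" using v by (simp add: unit_rel_normals_def)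
      from itr_le_unit_rel_normals(2)[OF this] show False using pos by simp
    qed
    then have "infdist (v, - v) (rel_limiting_normals A B xbar) \<noteq> 0"
      using in_closed_iff_infdist_zero[OF closed_rel_limiting_normals False] by blast
    then show ?thesis using False infdist_nonneg[of "(v, - v)"]
      by (simp add: dist_to_def order_less_le)
  qed
  then show "0 < itr3 A B xbar" using less_itr3_iff by blast
qed

section \<open>Exact bounds\<close>

lemma sup_or_eqI:
  assumes "0 \<le> m" "\<And>\<alpha>. \<alpha> \<in> T \<longleftrightarrow> 0 < \<alpha> \<and> \<alpha> < m"
  shows "sup_or 0 T = m"
proof -
  have T: "T = {0<..<m}" by (rule set_eqI) (simp add: assms(2))
  show ?thesis
  proof (cases "m = 0")
    case True
    then show ?thesis by (simp add: T sup_or_def)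
  next
    case False
    with assms(1) have "0 < m" by simp
    then have "{0<..<m} \<noteq> {}" by simp
    then show ?thesis unfolding T sup_or_def using \<open>0 < m\<close> by simp
  qed
qed

text \<open>The end point \<open>m\<close> may or may not belong to \<open>T\<close>: without unit pairs the least constant is
  admissible, otherwise the strict inequality excludes it.\<close>

lemma inf_or_eqI:
  assumes "m \<le> c" "T \<subseteq> {m..<c}" "{m<..<c} \<subseteq> T"
  shows "inf_or c T = m"
proof (cases "m = c")
  case True
  then show ?thesis using assms(2) by (auto simp: inf_or_def)
next
  case False
  with assms(1) have mc: "m < c" by simp
  then have ne: "{m<..<c} \<noteq> {}" "T \<noteq> {}" using assms(3) dense by fastforce+
  have "m \<le> Inf T" using ne(2) assms(2) by (intro cInf_greatest) auto
  moreover have "Inf T \<le> Inf {m<..<c}"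
    using ne(1) assms(2,3) by (intro cInf_superset_mono bdd_belowI[of T m]) auto
  ultimately show ?thesis using mc ne(2) by (simp add: inf_or_def)
qed

theorem theorem8:
  fixes A B :: "'a::euclidean_space set" and xbar :: 'a
  assumes "closed A" and "closed B" and "xbar \<in> A \<inter> B"
  shows
    "(intrinsically_transversal A B xbar \<longleftrightarrow>
        (\<exists>\<alpha>::real. 0 < \<alpha> \<and> \<alpha> < 1 \<and>
           (\<forall>(v1, v2) \<in> rel_limiting_normals A B xbar.
              norm v1 = 1 \<and> norm v2 = 1 \<longrightarrow> norm (v1 + v2) > \<alpha>)))
     \<and> sup_or 0 {\<alpha>. 0 < \<alpha> \<and> \<alpha> < 2 \<and>
           (\<forall>(v1, v2) \<in> rel_limiting_normals A B xbar.
              norm v1 = 1 \<and> norm v2 = 1 \<longrightarrow> norm (v1 + v2) > \<alpha>)}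
         = 2 * itr A B xbar
     \<and> sup_or 0 {\<alpha>. 0 < \<alpha> \<and> \<alpha> < 1 \<and>
           (\<forall>(v1, v2) \<in> rel_limiting_normals A B xbar.
              norm v1 = 1 \<and> norm v2 = 1 \<longrightarrow> norm (v1 + v2) > \<alpha>)}
         = min 1 (2 * itr A B xbar)

     \<and> (intrinsically_transversal A B xbar \<longleftrightarrow> itr1 A B xbar < 2)
     \<and> (itr1 A B xbar < 2 \<longleftrightarrow>
        (\<exists>\<alpha><2. \<forall>(v1, v2) \<in> rel_limiting_normals A B xbar.
              norm v1 = 1 \<and> norm v2 = 1 \<longrightarrow> norm (v1 - v2) < \<alpha>))
     \<and> inf_or 2 {\<alpha>. 0 \<le> \<alpha> \<and> \<alpha> < 2 \<and>
           (\<forall>(v1, v2) \<in> rel_limiting_normals A B xbar.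
              norm v1 = 1 \<and> norm v2 = 1 \<longrightarrow> norm (v1 - v2) < \<alpha>)}
         = itr1 A B xbar

     \<and> (intrinsically_transversal A B xbar \<longleftrightarrow> itr2 A B xbar < 1)
     \<and> (itr2 A B xbar < 1 \<longleftrightarrow>
        (\<exists>\<alpha><1. \<forall>(v1, v2) \<in> rel_limiting_normals A B xbar.
              norm v1 = 1 \<and> norm v2 = 1 \<longrightarrow> inner v1 v2 > - \<alpha>))
     \<and> inf_or 1 {\<alpha>. -1 \<le> \<alpha> \<and> \<alpha> < 1 \<and>
           (\<forall>(v1, v2) \<in> rel_limiting_normals A B xbar.
              norm v1 = 1 \<and> norm v2 = 1 \<longrightarrow> inner v1 v2 > - \<alpha>)}
         = itr2 A B xbar

     \<and> (intrinsically_transversal A B xbar \<longleftrightarrow> itr3 A B xbar > 0)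
     \<and> (itr3 A B xbar > 0 \<longleftrightarrow>
        (\<exists>\<alpha>::real. 0 < \<alpha> \<and> \<alpha> < 1 \<and>
           (\<forall>v. norm v = 1 \<longrightarrow> dist_to (v, - v) (rel_limiting_normals A B xbar) > \<alpha>)))
     \<and> sup_or 0 {\<alpha>. 0 < \<alpha> \<and>
           (\<forall>v. norm v = 1 \<longrightarrow> dist_to (v, - v) (rel_limiting_normals A B xbar) > \<alpha>)}
         = itr3 A B xbar
     \<and> sup_or 0 {\<alpha>. 0 < \<alpha> \<and> \<alpha> < 1 \<and>
           (\<forall>v. norm v = 1 \<longrightarrow> dist_to (v, - v) (rel_limiting_normals A B xbar) > \<alpha>)}
         = min 1 (itr3 A B xbar)"
proof -
  let ?N = "rel_limiting_normals A B xbar" and ?U = "unit_rel_normals A B xbar"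
  let ?i = "itr A B xbar" and ?i1 = "itr1 A B xbar" and ?i2 = "itr2 A B xbar" and ?i3 = "itr3 A B xbar"
  have unit: "(\<forall>(v1, v2)\<in>?N. norm v1 = 1 \<and> norm v2 = 1 \<longrightarrow> P v1 v2) \<longleftrightarrow> (\<forall>(v1, v2)\<in>?U. P v1 v2)"
    for P by (auto simp: unit_rel_normals_def)
  note i = itr_nonneg[of A B xbar] itr_le_1[of A B xbar]
  have ii: "0 < ?i \<longleftrightarrow> (\<exists>\<alpha>::real. 0 < \<alpha> \<and> \<alpha> < 1 \<and> (\<forall>(v1, v2)\<in>?U. \<alpha> < norm (v1 + v2)))"
  proof
    assume "0 < ?i"
    then obtain \<alpha> where "0 < \<alpha>" "\<alpha> < min 1 (2 * ?i)" using dense[of 0 "min 1 (2 * ?i)"] by auto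
    then show "\<exists>\<alpha>::real. 0 < \<alpha> \<and> \<alpha> < 1 \<and> (\<forall>(v1, v2)\<in>?U. \<alpha> < norm (v1 + v2))"
      using lower_bound_norm_add_iff[of \<alpha> A B xbar] by (intro exI[of _ \<alpha>]) auto
  next
    assume "\<exists>\<alpha>::real. 0 < \<alpha> \<and> \<alpha> < 1 \<and> (\<forall>(v1, v2)\<in>?U. \<alpha> < norm (v1 + v2))"
    then obtain \<alpha> :: real where "0 < \<alpha>" "\<alpha> < 1" "\<forall>(v1, v2)\<in>?U. \<alpha> < norm (v1 + v2)" by blast
    then show "0 < ?i" using lower_bound_norm_add_iff[of \<alpha> A B xbar] by simp
  qed
  have ii_sup: "sup_or 0 {\<alpha>. 0 < \<alpha> \<and> \<alpha> < c \<and> (\<forall>(v1, v2)\<in>?U. \<alpha> < norm (v1 + v2))} = min c (2 * ?i)"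
    if "0 < c" "c \<le> 2" for c :: real
  proof (rule sup_or_eqI)
    show "0 \<le> min c (2 * ?i)" using that i by simp
    show "\<alpha> \<in> {\<alpha>. 0 < \<alpha> \<and> \<alpha> < c \<and> (\<forall>(v1, v2)\<in>?U. \<alpha> < norm (v1 + v2))}
        \<longleftrightarrow> 0 < \<alpha> \<and> \<alpha> < min c (2 * ?i)" for \<alpha>
      using lower_bound_norm_add_iff[of \<alpha> A B xbar] that by auto
  qed
  have iii: "?i1 < 2 \<longleftrightarrow> (\<exists>\<alpha><2. \<forall>(v1, v2)\<in>?U. norm (v1 - v2) < \<alpha>)"
  proof
    assume "?i1 < 2"
    then obtain \<alpha> where "?i1 < \<alpha>" "\<alpha> < 2" using dense by blast
    then show "\<exists>\<alpha><2. \<forall>(v1, v2)\<in>?U. norm (v1 - v2) < \<alpha>"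
      using upper_bound_norm_diffI[of A B xbar \<alpha>] by (intro exI[of _ \<alpha>]) simp
  next
    assume "\<exists>\<alpha><2. \<forall>(v1, v2)\<in>?U. norm (v1 - v2) < \<alpha>"
    then obtain \<alpha> where \<alpha>: "\<alpha> < 2" "\<forall>(v1, v2)\<in>?U. norm (v1 - v2) < \<alpha>" by blast
    then show "?i1 < 2" using upper_bound_norm_diffD[OF \<alpha>(2)] by simp
  qed
  have iii_inf: "inf_or 2 {\<alpha>. 0 \<le> \<alpha> \<and> \<alpha> < 2 \<and> (\<forall>(v1, v2)\<in>?U. norm (v1 - v2) < \<alpha>)} = ?i1"
  proof (rule inf_or_eqI)
    show "{\<alpha>. 0 \<le> \<alpha> \<and> \<alpha> < 2 \<and> (\<forall>(v1, v2)\<in>?U. norm (v1 - v2) < \<alpha>)} \<subseteq> {?i1..<2}"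
    proof clarify
      fix \<alpha> assume \<alpha>: "0 \<le> \<alpha>" "\<alpha> < 2" "\<forall>(v1, v2)\<in>?U. norm (v1 - v2) < \<alpha>"
      show "\<alpha> \<in> {?i1..<2}" using upper_bound_norm_diffD[OF \<alpha>(3)] \<alpha>(1,2) by simp
    qed
    show "{?i1<..<2} \<subseteq> {\<alpha>. 0 \<le> \<alpha> \<and> \<alpha> < 2 \<and> (\<forall>(v1, v2)\<in>?U. norm (v1 - v2) < \<alpha>)}"
    proof
      fix \<alpha> assume \<alpha>: "\<alpha> \<in> {?i1<..<2}"
      then have "\<forall>(v1, v2)\<in>?U. norm (v1 - v2) < \<alpha>" using upper_bound_norm_diffI[of A B xbar \<alpha>] by simp
      with \<alpha> show "\<alpha> \<in> {\<alpha>. 0 \<le> \<alpha> \<and> \<alpha> < 2 \<and> (\<forall>(v1, v2)\<in>?U. norm (v1 - v2) < \<alpha>)}"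
        using itr1_bounds(1)[of A B xbar] by simp
    qed
  qed (rule itr1_bounds)
  have iv: "?i2 < 1 \<longleftrightarrow> (\<exists>\<alpha><1. \<forall>(v1, v2)\<in>?U. - \<alpha> < inner v1 v2)"
  proof
    assume "?i2 < 1"
    then obtain \<alpha> where "?i2 < \<alpha>" "\<alpha> < 1" using dense by blast
    then show "\<exists>\<alpha><1. \<forall>(v1, v2)\<in>?U. - \<alpha> < inner v1 v2"
      using lower_bound_innerI[of A B xbar \<alpha>] by (intro exI[of _ \<alpha>]) simp
  next
    assume "\<exists>\<alpha><1. \<forall>(v1, v2)\<in>?U. - \<alpha> < inner v1 v2"
    then obtain \<alpha> where \<alpha>: "\<alpha> < 1" "\<forall>(v1, v2)\<in>?U. - \<alpha> < inner v1 v2" by blast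
    then show "?i2 < 1" using lower_bound_innerD[OF \<alpha>(2)] by simp
  qed
  have iv_inf: "inf_or 1 {\<alpha>. - 1 \<le> \<alpha> \<and> \<alpha> < 1 \<and> (\<forall>(v1, v2)\<in>?U. - \<alpha> < inner v1 v2)} = ?i2"
  proof (rule inf_or_eqI)
    show "{\<alpha>. - 1 \<le> \<alpha> \<and> \<alpha> < 1 \<and> (\<forall>(v1, v2)\<in>?U. - \<alpha> < inner v1 v2)} \<subseteq> {?i2..<1}"
    proof clarify
      fix \<alpha> assume \<alpha>: "- 1 \<le> \<alpha>" "\<alpha> < 1" "\<forall>(v1, v2)\<in>?U. - \<alpha> < inner v1 v2"
      show "\<alpha> \<in> {?i2..<1}" using lower_bound_innerD[OF \<alpha>(3)] \<alpha>(1,2) by simp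
    qed
    show "{?i2<..<1} \<subseteq> {\<alpha>. - 1 \<le> \<alpha> \<and> \<alpha> < 1 \<and> (\<forall>(v1, v2)\<in>?U. - \<alpha> < inner v1 v2)}"
    proof
      fix \<alpha> assume \<alpha>: "\<alpha> \<in> {?i2<..<1}"
      then have "\<forall>(v1, v2)\<in>?U. - \<alpha> < inner v1 v2" using lower_bound_innerI[of A B xbar \<alpha>] by simp
      with \<alpha> show "\<alpha> \<in> {\<alpha>. - 1 \<le> \<alpha> \<and> \<alpha> < 1 \<and> (\<forall>(v1, v2)\<in>?U. - \<alpha> < inner v1 v2)}"
        using itr2_bounds(1)[of A B xbar] by simp
    qed
  qed (rule itr2_bounds)
  have v: "0 < ?i3 \<longleftrightarrow> (\<exists>\<alpha>::real. 0 < \<alpha> \<and> \<alpha> < 1 \<and> \<alpha> < ?i3)"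
    using dense[of 0 "min 1 ?i3"] by auto
  have v_sup: "sup_or 0 {\<alpha>. 0 < \<alpha> \<and> \<alpha> < ?i3} = ?i3"
    "sup_or 0 {\<alpha>. 0 < \<alpha> \<and> \<alpha> < 1 \<and> \<alpha> < ?i3} = min 1 ?i3"
    using itr3_nonneg[of A B xbar] by (auto intro!: sup_or_eqI)
  show ?thesis
    unfolding unit less_itr3_iff intrinsically_transversal_def
    using ii ii_sup[of 1] ii_sup[of 2] iii iii_inf iv iv_inf v v_sup i
      itr1_less_2_iff[of A B xbar] itr2_less_1_iff[of A B xbar] itr3_pos_iff[of A B xbar]
    by (intro conjI) simp_all
qed

end
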